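(* Let $(\mathcal{X},\mathcal{F})$ and $(\mathcal{T},\mathcal{G})$ be measurable spaces, let $\mu$ be a $\sigma$-finite measure on $(\mathcal{X},\mathcal{F})$, and let $T:\mathcal{X}\to\mathcal{T}$ be measurable (the image measure $\mu_T(C)=\mu(T^{-1}(C))$ is not assumed to be $\sigma$-finite). Then there exists a $\sigma$-finite conditional law $\mu^t(A)=\mu(A\mid T=t)$ of $\mu$ given $T=t$, and it is unique in the following sense: if $(\mu^t)$ and $(\tilde\mu^t)$ are two $\sigma$-finite conditional laws of $\mu$ given $T=t$, then there is a measurable function $c$ with values in $(0,\infty)$, defined for $\mu_T$-almost all $t\in\mathcal{T}$, such that for every $A\in\mathcal{F}$ one has $\tilde\mu^t(A)=c(t)\,\mu^t(A)$ for $\mu_T$-almost all $t$.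
   Context: Notation: $AB$ denotes $A\cap B$, and $[T\in C]=(T\in C)=T^{-1}(C)=\{x\in\mathcal{X} : T(x)\in C\}$. A property holds for almost all $t$ with respect to a measure $\nu$ on $(\mathcal{T},\mathcal{G})$ if it holds for all $t$ in a measurable set $E$ with $\nu(E^c)=0$. All functions of $t$ are only required to be defined almost everywhere, and the exceptional null set of $t\mapsto\mu^t(A)$ may depend on $A$. Strong random measure: Let $(\mathcal{X},\mathcal{F})$ be a measurable space and $(\mathcal{T},\mathcal{G},\nu)$ a measure space. Suppose that for each $A\in\mathcal{F}$ a measurable function $t\mapsto\mu^t(A)\in[0,\infty]$ is given ($\nu$-almost everywhere defined). This family is a strong random measure on $\mathcal{F}$ with respect to $\nu$ if (1) $\mu^t(\emptyset)=0$ for $\nu$-almost all $t$; and (2) for every sequence of pairwise disjoint sets $A_1,A_2,\ldots\in\mathcal{F}$, $\mu^t(\bigcup_i A_i)=\sum_i\mu^t(A_i)$ for $\nu$-almost all $t$ (the exceptional null set may depend on the sequence). A strong random measure is $\sigma$-finite if there exist $B_1,B_2,\ldots\in\mathcal{F}$ with $\mathcal{X}=\bigcup_n B_n$ and, for each $n$, $0<\mu^t(B_n)<\infty$ for almost all $t$. Conditional law: Let $\mu$ be a measure on $(\mathcal{X},\mathcal{F})$ and $T:\mathcal{X}\to\mathcal{T}$ measurable. A strong random measure $(\mu^t)$ on $\mathcal{F}$ with respect to $\mu_T$, where $\mu_T(C)=\mu(T\in C)$, is a conditional law of $\mu$ given $T=t$, written $\mu^t(A)=\mu(A\mid T=t)$,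 if $$\mu(A\,[T\in C]\mid B)=\int_C \mu^t(A\mid B)\,\mu_T(dt\mid B)$$ for all $A\in\mathcal{F}$, all $C\in\mathcal{G}$ and all $B\in\mathcal{F}$ with $0<\mu(B)<\infty$. Here $\mu(F\mid B)=\mu(FB)$ (with no normalization), $\mu_T(D\mid B)=\mu([T\in D]\mid B)=\mu([T\in D]\,B)$, and $\mu^t(A\mid B)=\mu^t(AB)/\mu^t(B)$, where it is part of the requirement that this quotient is defined, i.e. $0<\mu^t(B)<\infty$, for $\mu_T(\cdot\mid B)$-almost all $t$. *)

theory Defs
  imports "HOL-Probability.Probability"
begin

(* Functions that are only defined \<nu>-almost everywhere are total functions whose values
   off a conull measurable set E are arbitrary; nothing is required of them there.
   All properties below that involve such functions are insensitive to null sets. *)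
definition ae_borel_measurable :: "'t measure \<Rightarrow> ('t \<Rightarrow> ennreal) \<Rightarrow> bool" where
  "ae_borel_measurable \<nu> f \<longleftrightarrow>
     (\<exists>E\<in>sets \<nu>. space \<nu> - E \<in> null_sets \<nu> \<and> f \<in> borel_measurable (restrict_space \<nu> E))"

(* Only the space and the sigma-algebra of F matter, not its measure. *)
definition strong_random_measure ::
    "'x measure \<Rightarrow> 't measure \<Rightarrow> ('t \<Rightarrow> 'x set \<Rightarrow> ennreal) \<Rightarrow> bool" where
  "strong_random_measure F \<nu> m \<longleftrightarrow>
     (\<forall>A\<in>sets F. ae_borel_measurable \<nu> (\<lambda>t. m t A)) \<and>
     (AE t in \<nu>. m t {} = 0) \<and>
     (\<forall>A :: nat \<Rightarrow> 'x set. range A \<subseteq> sets F \<longrightarrow> disjoint_family A \<longrightarrow>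
        (AE t in \<nu>. m t (\<Union>i. A i) = (\<Sum>i. m t (A i))))"

definition sigma_finite_srm ::
    "'x measure \<Rightarrow> 't measure \<Rightarrow> ('t \<Rightarrow> 'x set \<Rightarrow> ennreal) \<Rightarrow> bool" where
  "sigma_finite_srm F \<nu> m \<longleftrightarrow>
     strong_random_measure F \<nu> m \<and>
     (\<exists>B :: nat \<Rightarrow> 'x set. range B \<subseteq> sets F \<and> space F = (\<Union>n. B n) \<and>
        (\<forall>n. AE t in \<nu>. 0 < m t (B n) \<and> m t (B n) < \<infinity>))"

(* The unnormalized conditional measure \<mu>(F | B) = \<mu>(F \<inter> B). *)
definition cond_on :: "'x measure \<Rightarrow> 'x set \<Rightarrow> 'x measure" where
  "cond_on \<mu> B = density \<mu> (indicator B)"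

lemma emeasure_cond_on:
  assumes "B \<in> sets \<mu>" "F \<in> sets \<mu>"
  shows "emeasure (cond_on \<mu> B) F = emeasure \<mu> (F \<inter> B)"
  using assms by (simp add: cond_on_def emeasure_restricted Int_commute)

(* The quotient \<mu>^t(A | B) = \<mu>^t(A \<inter> B) / \<mu>^t(B) has a junk value in ennreal unless
   0 < \<mu>^t(B) < \<infinity>, so that condition is imposed separately. *)
definition conditional_law ::
    "'x measure \<Rightarrow> 't measure \<Rightarrow> ('x \<Rightarrow> 't) \<Rightarrow> ('t \<Rightarrow> 'x set \<Rightarrow> ennreal) \<Rightarrow> bool" where
  "conditional_law \<mu> G T m \<longleftrightarrow>
     strong_random_measure \<mu> (distr \<mu> G T) m \<and>
     (\<forall>B\<in>sets \<mu>. 0 < emeasure \<mu> B \<and> emeasure \<mu> B < \<infinity> \<longrightarrow>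
        (AE t in distr (cond_on \<mu> B) G T. 0 < m t B \<and> m t B < \<infinity>) \<and>
        (\<forall>A\<in>sets \<mu>. \<forall>C\<in>sets G.
           emeasure (cond_on \<mu> B) (A \<inter> (T -` C \<inter> space \<mu>)) =
           (\<integral>\<^sup>+t\<in>C. (m t (A \<inter> B) / m t B) \<partial>(distr (cond_on \<mu> B) G T))))"

definition sigma_finite_conditional_law ::
    "'x measure \<Rightarrow> 't measure \<Rightarrow> ('x \<Rightarrow> 't) \<Rightarrow> ('t \<Rightarrow> 'x set \<Rightarrow> ennreal) \<Rightarrow> bool" where
  "sigma_finite_conditional_law \<mu> G T m \<longleftrightarrow>
     conditional_law \<mu> G T m \<and> sigma_finite_srm \<mu> (distr \<mu> G T) m"

end

theory Submission
  imports Defs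
begin

text \<open>
  Existence: choose a finite measure equivalent to \<open>\<mu>\<close> and let \<open>M\<close> be its image under \<open>T\<close>.
  For each \<open>A\<close> let \<open>\<mu>\<^sup>t(A)\<close> be the density of \<open>\<mu>(A [T \<in> \<cdot>])\<close> with respect to \<open>M\<close>; it exists although
  this image measure need not be \<open>\<sigma>\<close>-finite. If \<open>D\<^sub>n\<close> increases to the whole space with
  \<open>\<mu>(D\<^sub>n) < \<infinity>\<close>, and \<open>N(t)\<close> is the first \<open>n\<close> with \<open>\<mu>\<^sup>t(D\<^sub>n) > 0\<close>, then the sets
  \<open>{x. x \<in> D\<^bsub>N(T x) + k\<^esub>}\<close> witness \<open>\<sigma>\<close>-finiteness.

  Uniqueness: for disjoint \<open>D\<^sub>n\<close> of finite measure, conditioning on \<open>D\<^sub>n \<union> D\<^sub>j\<close> gives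
  \<open>\<mu>'\<^sup>t(A D\<^sub>j) = k \<mu>\<^sup>t(A D\<^sub>j)\<close> with \<open>k = \<mu>'\<^sup>t(D\<^sub>n) / \<mu>\<^sup>t(D\<^sub>n)\<close>, for almost all \<open>t\<close> with respect to
  \<open>\<mu>\<^sub>T(\<cdot> | D\<^sub>n)\<close>. Since \<open>k\<close> depends neither on \<open>j\<close> nor on \<open>A\<close>, summing over \<open>j\<close> gives
  \<open>\<mu>'\<^sup>t(A) = k \<mu>\<^sup>t(A)\<close>, so \<open>k = \<mu>'\<^sup>t(U) / \<mu>\<^sup>t(U)\<close> for any \<open>U\<close> with \<open>0 < \<mu>\<^sup>t(U) < \<infinity>\<close>,
  which does not involve \<open>n\<close>. A property that holds \<open>\<mu>\<^sub>T(\<cdot> | D\<^sub>n)\<close>-almost everywhere for all \<open>n\<close>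
  holds \<open>\<mu>\<^sub>T\<close>-almost everywhere.
\<close>

text \<open>Gives access to a total Borel version: a function measurable on a conull
  \<open>E\<close> is continued by 0 off \<open>E\<close>, and conversely \<open>E\<close> can be
  taken as the complement of a null set outside which the two functions agree.\<close>

lemma ae_borel_measurable_iff:
  "ae_borel_measurable \<nu> f \<longleftrightarrow> (\<exists>g\<in>borel_measurable \<nu>. AE t in \<nu>. f t = g t)"
proof
  assume "ae_borel_measurable \<nu> f"
  then obtain E where E: "E \<in> sets \<nu>" "space \<nu> - E \<in> null_sets \<nu>"
    "f \<in> borel_measurable (restrict_space \<nu> E)"
    unfolding ae_borel_measurable_def by blast
  have "(\<lambda>t. f t * indicator E t) \<in> borel_measurable \<nu>"
    using E borel_measurable_restrict_space_iff_ennreal[of E \<nu> f] by (simp add: sets.Int_space_eq2)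
  moreover have "AE t in \<nu>. f t = f t * indicator E t"
    by (rule AE_I'[OF E(2)]) (auto simp: indicator_def)
  ultimately show "\<exists>g\<in>borel_measurable \<nu>. AE t in \<nu>. f t = g t"
    by (intro bexI[of _ "\<lambda>t. f t * indicator E t"])
next
  assume "\<exists>g\<in>borel_measurable \<nu>. AE t in \<nu>. f t = g t"
  then obtain g where g: "g \<in> borel_measurable \<nu>" "AE t in \<nu>. f t = g t" by blast
  from AE_E3[OF g(2)] obtain N where
    N: "N \<in> null_sets \<nu>" "\<And>t. t \<in> space \<nu> - N \<Longrightarrow> f t = g t"
    by blast
  have "f \<in> borel_measurable (restrict_space \<nu> (space \<nu> - N)) \<longleftrightarrow>
      g \<in> borel_measurable (restrict_space \<nu> (space \<nu> - N))"
    by (rule measurable_cong) (auto simp: space_restrict_space N(2))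
  then have "f \<in> borel_measurable (restrict_space \<nu> (space \<nu> - N))"
    using g(1) by (simp add: measurable_restrict_space1)
  moreover have "space \<nu> - (space \<nu> - N) = N"
    using N(1) by (auto dest: null_setsD2 sets.sets_into_space)
  ultimately show "ae_borel_measurable \<nu> f"
    unfolding ae_borel_measurable_def using N(1)
    by (intro bexI[of _ "space \<nu> - N"]) auto
qed

text \<open>Both functions are densities of one measure, and densities with respect to a
  \<sigma>-finite measure are unique, even with infinite values. Identities between measures thus
  become a.e. identities between densities.\<close>

lemma (in sigma_finite_measure) AE_eq_if_set_nn_integral_eq:
  assumes [measurable]: "f \<in> borel_measurable M" "g \<in> borel_measurable M"
    and "\<And>C. C \<in> sets M \<Longrightarrow> (\<integral>\<^sup>+t\<in>C. f t \<partial>M) = (\<integral>\<^sup>+t\<in>C. g t \<partial>M)"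
  shows "AE t in M. f t = g t"
  by (intro density_unique measure_eqI) (auto simp: emeasure_density assms(3))

lemma sets_cond_on[simp, measurable_cong]: "sets (cond_on \<mu> B) = sets \<mu>"
  by (simp add: cond_on_def)

lemma space_cond_on[simp]: "space (cond_on \<mu> B) = space \<mu>"
  by (simp add: cond_on_def)

section \<open>Null sets and almost-everywhere statements for images under \<open>T\<close>\<close>

locale measurable_map =
  fixes \<mu> :: "'x measure" and G :: "'t measure" and T :: "'x \<Rightarrow> 't"
  assumes T[measurable]: "T \<in> measurable \<mu> G"
begin

abbreviation image_law :: "'t measure" where
  "image_law \<equiv> distr \<mu> G T"

abbreviation image_law_on :: "'x set \<Rightarrow> 't measure" where
  "image_law_on A \<equiv> distr (cond_on \<mu> A) G T"

lemma emeasure_image_law_on: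
  assumes [measurable]: "A \<in> sets \<mu>" "C \<in> sets G"
  shows "emeasure (image_law_on A) C = emeasure \<mu> ((T -` C \<inter> space \<mu>) \<inter> A)"
proof -
  have "T \<in> measurable (cond_on \<mu> A) G" by measurable
  then show ?thesis by (simp add: emeasure_distr emeasure_cond_on)
qed

lemma null_sets_image_law_on:
  assumes [measurable]: "A \<in> sets \<mu>"
  shows "C \<in> null_sets (image_law_on A) \<longleftrightarrow> C \<in> sets G \<and> (T -` C \<inter> space \<mu>) \<inter> A \<in> null_sets \<mu>"
  using emeasure_image_law_on[OF assms, of C] by (auto simp: null_sets_def)

lemma AE_image_law_on_mono:
  assumes "A \<in> sets \<mu>" "B \<in> sets \<mu>" "A \<subseteq> B" "AE t in image_law_on B. P t"
  shows "AE t in image_law_on A. P t"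
proof -
  have "C \<in> null_sets (image_law_on A)" if "C \<in> null_sets (image_law_on B)" for C
    using that assms(1-3) by (auto simp: null_sets_image_law_on intro: null_sets_subset)
  then show ?thesis
    using assms(4) unfolding eventually_ae_filter by auto
qed

lemma AE_image_law_onI:
  assumes "A \<in> sets \<mu>" "AE t in image_law. P t"
  shows "AE t in image_law_on A. P t"
proof -
  have "C \<in> null_sets (image_law_on A)" if "C \<in> null_sets image_law" for C
    using that assms(1)
    by (auto simp: null_sets_image_law_on null_sets_distr_iff[OF T] intro: null_set_Int2)
  then show ?thesis
    using assms(2) unfolding eventually_ae_filter by auto
qed

lemma AE_image_law_if_cover:
  fixes D :: "nat \<Rightarrow> 'x set"
  assumes D: "range D \<subseteq> sets \<mu>" "(\<Union>n. D n) = space \<mu>"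
    and P: "\<And>n. AE t in image_law_on (D n). P t"
  shows "AE t in image_law. P t"
proof -
  have "\<exists>N. N \<in> null_sets (image_law_on (D n)) \<and> {t \<in> space G. \<not> P t} \<subseteq> N" for n
    using P[of n] unfolding eventually_ae_filter by auto
  then obtain N where N: "\<And>n. N n \<in> null_sets (image_law_on (D n))"
    "\<And>n. {t \<in> space G. \<not> P t} \<subseteq> N n"
    by metis
  have N': "N n \<in> sets G" "T -` N n \<inter> space \<mu> \<inter> D n \<in> null_sets \<mu>" for n
    using N(1)[of n] D(1) by (auto simp: null_sets_image_law_on)
  have "(\<Inter>n. N n) \<in> sets G" using N' by auto
  moreover have "T -` (\<Inter>n. N n) \<inter> space \<mu> \<in> null_sets \<mu>"
  proof (rule null_sets_subset)
    show "(\<Union>n. T -` N n \<inter> space \<mu> \<inter> D n) \<in> null_sets \<mu>" using N' by auto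
    show "T -` (\<Inter>n. N n) \<inter> space \<mu> \<in> sets \<mu>"
      using calculation by measurable
    show "T -` (\<Inter>n. N n) \<inter> space \<mu> \<subseteq> (\<Union>n. T -` N n \<inter> space \<mu> \<inter> D n)"
      using D(2) by blast
  qed
  ultimately have "(\<Inter>n. N n) \<in> null_sets image_law"
    by (simp add: null_sets_distr_iff)
  then show ?thesis
    by (rule AE_I') (use N(2) in auto)
qed

subsection \<open>Uniqueness\<close>

text \<open>Both quotients are densities of the same measure
  \<open>\<mu>(A [T \<in> \<cdot>] | B)\<close> with respect to \<open>image_law_on B\<close>, which
  is finite because \<open>B\<close> has finite measure.\<close>

lemma conditional_law_cross_ratio:
  assumes m: "conditional_law \<mu> G T m" and m': "conditional_law \<mu> G T m'"
    and B: "B \<in> sets \<mu>" "0 < emeasure \<mu> B" "emeasure \<mu> B < \<infinity>" and A: "A \<in> sets \<mu>"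
  shows "AE t in image_law_on B. m t (A \<inter> B) / m t B = m' t (A \<inter> B) / m' t B"
proof -
  \<comment> \<open>Uniqueness of densities asks for measurable functions, whereas a law is only
    a.e. measurable; numerator and denominator are first replaced by Borel versions.\<close>
  have ver: "\<exists>g\<in>borel_measurable G. AE t in image_law_on B. n t E = g t"
    if "conditional_law \<mu> G T n" "E \<in> sets \<mu>" for n E
  proof -
    from that have "ae_borel_measurable image_law (\<lambda>t. n t E)"
      by (simp add: conditional_law_def strong_random_measure_def)
    then show ?thesis
      using AE_image_law_onI[OF B(1)] by (fastforce simp: ae_borel_measurable_iff)
  qed
  have quot: "\<exists>q\<in>borel_measurable G. (AE t in image_law_on B. n t (A \<inter> B) / n t B = q t) \<and>
      (\<forall>C\<in>sets G. emeasure (cond_on \<mu> B) (A \<inter> (T -` C \<inter> space \<mu>)) =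
        (\<integral>\<^sup>+t\<in>C. q t \<partial>(image_law_on B)))"
    if n: "conditional_law \<mu> G T n" for n
  proof -
    obtain g where g: "g \<in> borel_measurable G" "AE t in image_law_on B. n t (A \<inter> B) = g t"
      using ver[OF n, of "A \<inter> B"] A B by auto
    obtain h where h: "h \<in> borel_measurable G" "AE t in image_law_on B. n t B = h t"
      using ver[OF n, of B] B by auto
    have ae: "AE t in image_law_on B. n t (A \<inter> B) / n t B = g t / h t"
      using g(2) h(2) by eventually_elim simp
    have "emeasure (cond_on \<mu> B) (A \<inter> (T -` C \<inter> space \<mu>)) =
        (\<integral>\<^sup>+t\<in>C. (g t / h t) \<partial>(image_law_on B))" if C: "C \<in> sets G" for C
    proof -
      have "emeasure (cond_on \<mu> B) (A \<inter> (T -` C \<inter> space \<mu>)) =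
          (\<integral>\<^sup>+t\<in>C. (n t (A \<inter> B) / n t B) \<partial>(image_law_on B))"
        using n A B C unfolding conditional_law_def by blast
      also have "\<dots> = (\<integral>\<^sup>+t\<in>C. (g t / h t) \<partial>(image_law_on B))"
        by (rule nn_integral_cong_AE) (use ae in \<open>eventually_elim, simp\<close>)
      finally show ?thesis .
    qed
    then show ?thesis
      using ae g(1) h(1) by (intro bexI[of _ "\<lambda>t. g t / h t"]) auto
  qed
  obtain q where q: "q \<in> borel_measurable G"
    "AE t in image_law_on B. m t (A \<inter> B) / m t B = q t"
    "\<And>C. C \<in> sets G \<Longrightarrow> emeasure (cond_on \<mu> B) (A \<inter> (T -` C \<inter> space \<mu>)) =
        (\<integral>\<^sup>+t\<in>C. q t \<partial>(image_law_on B))"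
    using quot[OF m] by blast
  obtain q' where q': "q' \<in> borel_measurable G"
    "AE t in image_law_on B. m' t (A \<inter> B) / m' t B = q' t"
    "\<And>C. C \<in> sets G \<Longrightarrow> emeasure (cond_on \<mu> B) (A \<inter> (T -` C \<inter> space \<mu>)) =
        (\<integral>\<^sup>+t\<in>C. q' t \<partial>(image_law_on B))"
    using quot[OF m'] by blast
  interpret \<nu>: finite_measure "image_law_on B"
  proof
    have "emeasure (image_law_on B) (space G) \<le> emeasure \<mu> B"
      using B by (simp add: emeasure_image_law_on emeasure_mono)
    then show "emeasure (image_law_on B) (space (image_law_on B)) \<noteq> \<infinity>"
      using B(3) by auto
  qed
  have "AE t in image_law_on B. q t = q' t"
    by (rule \<nu>.AE_eq_if_set_nn_integral_eq) (use q q' in auto)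
  then show ?thesis
    using q(2) q'(2) by eventually_elim simp
qed

text \<open>The cross ratios on \<open>B\<close> for \<open>A\<close> and for \<open>D\<close> share
  the factor \<open>m' t B / m t B\<close>; dividing one by the other eliminates it. The division is
  legitimate almost everywhere for \<open>image_law_on D\<close>, where \<open>m t D\<close> is
  positive and finite.\<close>

lemma conditional_law_proportional_on:
  assumes m: "conditional_law \<mu> G T m" and m': "conditional_law \<mu> G T m'"
    and B: "B \<in> sets \<mu>" "0 < emeasure \<mu> B" "emeasure \<mu> B < \<infinity>"
    and sets: "A \<in> sets \<mu>" "D \<in> sets \<mu>" "0 < emeasure \<mu> D"
    and sub: "A \<subseteq> B" "D \<subseteq> B"
  shows "AE t in image_law_on D. m' t A = (m' t D / m t D) * m t A"
proof -
  have D_fin: "emeasure \<mu> D < \<infinity>"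
    using emeasure_mono[OF sub(2) B(1)] B(3) by (rule le_less_trans)
  have bd: "AE t in image_law_on E. 0 < n t E \<and> n t E < \<infinity>"
    if "conditional_law \<mu> G T n" "E \<in> sets \<mu>" "0 < emeasure \<mu> E" "emeasure \<mu> E < \<infinity>" for n E
    using that unfolding conditional_law_def by blast
  note lift = AE_image_law_on_mono[OF sets(2) B(1) sub(2)]
  have "A \<inter> B = A" "D \<inter> B = D" using sub by auto
  with lift[OF conditional_law_cross_ratio[OF m m' B sets(1)]]
    lift[OF conditional_law_cross_ratio[OF m m' B sets(2)]]
  have "AE t in image_law_on D. m t A / m t B = m' t A / m' t B"
    "AE t in image_law_on D. m t D / m t B = m' t D / m' t B" by simp_all
  with lift[OF bd[OF m B]] lift[OF bd[OF m' B]] bd[OF m sets(2,3) D_fin] bd[OF m' sets(2,3) D_fin]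
  show ?thesis
  proof eventually_elim
    case (elim t)
    define a b d a' b' d' where defs: "a = m t A" "b = m t B" "d = m t D"
      "a' = m' t A" "b' = m' t B" "d' = m' t D"
    have *: "0 < b" "b < \<top>" "0 < b'" "b' < \<top>" "0 < d" "d < \<top>" "0 < d'" "d' < \<top>"
      "a / b = a' / b'" "d / b = d' / b'"
      using elim by (auto simp: defs)
    have "x' = x / b * b'" if "x / b = x' / b'" for x x'
      using that * by (simp add: divide_mult_eq ennreal_divide_times ennreal_mult_divide_eq)
    then have "a' = a / b * b'" "d' = d / b * b'" using * by blast+
    then have "d' / d * a = (d / d) * (a / b * b')"
      by (simp add: divide_ennreal_def mult_ac)
    also have "d / d = 1" using * by (simp add: ennreal_divide_self)
    finally show ?case using \<open>a' = a / b * b'\<close> by (simp add: defs)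
  qed
qed

lemma conditional_law_proportional:
  fixes D :: "nat \<Rightarrow> 'x set"
  assumes m: "conditional_law \<mu> G T m" and m': "conditional_law \<mu> G T m'"
    and D: "range D \<subseteq> sets \<mu>" "(\<Union>n. D n) = space \<mu>" "\<And>n. emeasure \<mu> (D n) \<noteq> \<infinity>"
      "disjoint_family D"
    and pos: "0 < emeasure \<mu> (D n)" and A: "A \<in> sets \<mu>"
  shows "AE t in image_law_on (D n). m' t A = (m' t (D n) / m t (D n)) * m t A"
proof -
  have Dn: "D j \<in> sets \<mu>" for j using D(1) by auto
  have "AE t in image_law_on (D n). m' t (A \<inter> D j) = (m' t (D n) / m t (D n)) * m t (A \<inter> D j)" for j
  \<comment> \<open>The union has finite measure and contains both \<open>D n\<close> and
    \<open>A \<inter> D j\<close>; its positivity comes from \<open>D n\<close>, since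
    \<open>D j\<close> may be null.\<close>
  proof (rule conditional_law_proportional_on[OF m m', of "D n \<union> D j"])
    show "0 < emeasure \<mu> (D n \<union> D j)"
      using pos emeasure_mono[of "D n" "D n \<union> D j" \<mu>] Dn by (auto intro: less_le_trans)
    have "emeasure \<mu> (D n \<union> D j) \<le> emeasure \<mu> (D n) + emeasure \<mu> (D j)"
      using Dn by (intro emeasure_subadditive)
    also have "\<dots> < \<infinity>" using D(3)[of n] D(3)[of j] by (simp add: less_top)
    finally show "emeasure \<mu> (D n \<union> D j) < \<infinity>" .
  qed (use Dn A pos in auto)
  then have each: "AE t in image_law_on (D n). \<forall>j.
      m' t (A \<inter> D j) = (m' t (D n) / m t (D n)) * m t (A \<inter> D j)"
    by (simp add: AE_all_countable)
  have fam: "range (\<lambda>j. A \<inter> D j) \<subseteq> sets \<mu>" "disjoint_family (\<lambda>j. A \<inter> D j)"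
    using Dn A D(4) by (auto simp: disjoint_family_on_def)
  have un: "(\<Union>j. A \<inter> D j) = A"
    using D(2) sets.sets_into_space[OF A] by auto
  have "AE t in image_law_on (D n). l t A = (\<Sum>j. l t (A \<inter> D j))"
    if "conditional_law \<mu> G T l" for l
  proof (rule AE_image_law_onI[OF Dn])
    from that have "strong_random_measure \<mu> image_law l"
      by (simp add: conditional_law_def)
    with fam have "AE t in image_law. l t (\<Union>j. A \<inter> D j) = (\<Sum>j. l t (A \<inter> D j))"
      unfolding strong_random_measure_def by blast
    then show "AE t in image_law. l t A = (\<Sum>j. l t (A \<inter> D j))" unfolding un .
  qed
  from this[OF m] this[OF m'] each show ?thesis
    by eventually_elim (simp add: ennreal_suminf_cmult)
qed

lemma sigma_finite_conditional_law_unique: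
  assumes "sigma_finite_measure \<mu>"
    and m: "sigma_finite_conditional_law \<mu> G T m" and m': "sigma_finite_conditional_law \<mu> G T m'"
  shows "\<exists>c. ae_borel_measurable image_law c \<and> (AE t in image_law. 0 < c t \<and> c t < \<infinity>) \<and>
    (\<forall>A\<in>sets \<mu>. AE t in image_law. m' t A = c t * m t A)"
proof -
  have cl: "conditional_law \<mu> G T m" "conditional_law \<mu> G T m'"
    using m m' by (auto simp: sigma_finite_conditional_law_def)
  obtain B :: "nat \<Rightarrow> 'x set" where "range B \<subseteq> sets \<mu>"
    "\<And>n. AE t in image_law. 0 < m t (B n) \<and> m t (B n) < \<infinity>"
    using m by (auto simp: sigma_finite_conditional_law_def sigma_finite_srm_def)
  then obtain U where U: "U \<in> sets \<mu>" "AE t in image_law. 0 < m t U \<and> m t U < \<infinity>"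
    by blast
  \<comment> \<open>Fixing a single \<open>U\<close> makes the factor independent of
    \<open>n\<close>, so the statements on the pieces \<open>D n\<close> can be glued.\<close>
  define c where "c t = m' t U / m t U" for t
  obtain D :: "nat \<Rightarrow> 'x set" where D: "range D \<subseteq> sets \<mu>" "(\<Union>n. D n) = space \<mu>"
    "\<And>n. emeasure \<mu> (D n) \<noteq> \<infinity>" "disjoint_family D"
    using sigma_finite_measure.sigma_finite_disjoint[OF assms(1)] by blast
  have Dn: "D n \<in> sets \<mu>" for n using D(1) by auto
  have ae_c: "AE t in image_law_on (D n). 0 < c t \<and> c t < \<infinity> \<and> m' t A = c t * m t A"
    if A: "A \<in> sets \<mu>" for n A
  proof (cases "emeasure \<mu> (D n) = 0")
    \<comment> \<open>Here \<open>image_law_on (D n)\<close> is the zero measure. The case is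
      separate because a conditional law is constrained only on sets of positive measure.\<close>
    case True
    then have "space (image_law_on (D n)) \<in> null_sets (image_law_on (D n))"
      using Dn by (auto simp: null_sets_image_law_on null_setsI null_set_Int1)
    then show ?thesis by (rule AE_I') auto
  next
    case False
    then have pos: "0 < emeasure \<mu> (D n)" by (simp add: zero_less_iff_neq_zero)
    have bd: "AE t in image_law_on (D n). 0 < l t (D n) \<and> l t (D n) < \<infinity>"
      if "conditional_law \<mu> G T l" for l
      using that Dn D(3) pos unfolding conditional_law_def by (metis less_top infinity_ennreal_def)
    from bd[OF cl(1)] bd[OF cl(2)] AE_image_law_onI[OF Dn U(2), of n]
      conditional_law_proportional[OF cl D pos A] conditional_law_proportional[OF cl D pos U(1)]
    show ?thesis
    proof eventually_elim
      case (elim t)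
      \<comment> \<open>No bounds on \<open>m' t U\<close> are at hand, so those on \<open>c\<close>
        come from \<open>D n\<close> through \<open>k\<close>. Dividing
        \<open>m' t U = k * m t U\<close> by the positive finite \<open>m t U\<close> gives
        \<open>c t = k\<close>.\<close>
      define k where "k = m' t (D n) / m t (D n)"
      have "0 < k" "k < \<infinity>"
        using elim by (auto simp: k_def ennreal_zero_less_divide ennreal_divide_eq_top_iff less_top[symmetric])
      moreover have "c t = k"
        using elim unfolding c_def k_def[symmetric] by (auto simp: less_top ennreal_mult_divide_eq)
      ultimately show ?case using elim by (simp add: k_def)
    qed
  qed
  have c: "AE t in image_law. 0 < c t \<and> c t < \<infinity> \<and> m' t A = c t * m t A" if "A \<in> sets \<mu>" for A
    using AE_image_law_if_cover[OF D(1,2) ae_c[OF that]] .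
  have "ae_borel_measurable image_law c"
  proof -
    have "ae_borel_measurable image_law (\<lambda>t. m t U)" "ae_borel_measurable image_law (\<lambda>t. m' t U)"
      using cl U(1) by (auto simp: conditional_law_def strong_random_measure_def)
    then obtain g g' where g: "g \<in> borel_measurable image_law" "AE t in image_law. m t U = g t"
      "g' \<in> borel_measurable image_law" "AE t in image_law. m' t U = g' t"
      unfolding ae_borel_measurable_iff by blast
    from g(2,4) have ratio: "AE t in image_law. c t = g' t / g t"
      by eventually_elim (simp add: c_def)
    have "(\<lambda>t. g' t / g t) \<in> borel_measurable image_law"
      using g(1,3) by measurable
    then show ?thesis
      unfolding ae_borel_measurable_iff by (rule bexI[rotated]) (rule ratio)
  qed
  moreover have "AE t in image_law. 0 < c t \<and> c t < \<infinity>"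
    using c[OF U(1)] by eventually_elim simp
  moreover have "AE t in image_law. m' t A = c t * m t A" if "A \<in> sets \<mu>" for A
    using c[OF that] by eventually_elim simp
  ultimately show ?thesis by blast
qed

subsection \<open>Existence\<close>

lemma sigma_finite_conditional_law_exists:
  assumes "sigma_finite_measure \<mu>"
  shows "\<exists>m. sigma_finite_conditional_law \<mu> G T m"
proof -

  \<comment> \<open>A finite measure with the null sets of \<open>image_law\<close>\<close>
  interpret \<mu>: sigma_finite_measure \<mu> by fact
  obtain h where h[measurable]: "h \<in> borel_measurable \<mu>" and h_fin: "integral\<^sup>N \<mu> h \<noteq> \<infinity>"
    and h_pos: "\<And>x. x \<in> space \<mu> \<Longrightarrow> 0 < h x"
    using \<mu>.Ex_finite_integrable_function by blast
  define M where "M = distr (density \<mu> h) G T"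
  have sets_M[simp, measurable_cong]: "sets M = sets G" and space_M[simp]: "space M = space G"
    by (auto simp: M_def)
  have T_h: "T \<in> measurable (density \<mu> h) G" by measurable
  interpret M: finite_measure M
  proof
    have "emeasure M (space M) = integral\<^sup>N \<mu> h"
      using T_h measurable_space[OF T]
      by (auto simp: M_def emeasure_distr emeasure_density intro!: nn_integral_cong)
    then show "emeasure M (space M) \<noteq> \<infinity>" using h_fin by simp
  qed
  have null_h: "C \<in> null_sets (density \<mu> h) \<longleftrightarrow> C \<in> null_sets \<mu>" for C
  proof -
    have "C \<in> null_sets (density \<mu> h) \<longleftrightarrow> C \<in> sets \<mu> \<and> (AE x in \<mu>. x \<in> C \<longrightarrow> h x = 0)"
      by (rule null_sets_density_iff[OF h])
    also have "\<dots> \<longleftrightarrow> C \<in> sets \<mu> \<and> (AE x in \<mu>. x \<notin> C)"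
      by (intro conj_cong refl AE_cong) (use h_pos in force)
    also have "\<dots> \<longleftrightarrow> C \<in> null_sets \<mu>"
      by (auto simp: AE_iff_null_sets AE_not_in)
    finally show ?thesis .
  qed
  have null_M: "null_sets M = null_sets image_law"
    by (auto simp: M_def null_sets_distr_iff[OF T_h] null_sets_distr_iff[OF T] null_h)
  have AE_M: "(AE t in image_law. P t) \<longleftrightarrow> (AE t in M. P t)" for P
    unfolding eventually_ae_filter null_M by simp
  \<comment> \<open>Finiteness of \<open>M\<close> and absolute continuity suffice for this density,
    which may take the value \<infinity>. Each \<open>A\<close> gets its own choice, so relations
    between different sets can only be expected almost everywhere.\<close>
  define m where "m t A = RN_deriv M (image_law_on A) t" for t A
  have m_meas[measurable]: "(\<lambda>t. m t A) \<in> borel_measurable G" for A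
    using borel_measurable_RN_deriv[of M "image_law_on A"] by (simp add: m_def[abs_def] cong: measurable_cong_sets)
  have dens: "density M (\<lambda>t. m t A) = image_law_on A" if "A \<in> sets \<mu>" for A
  proof -
    have "absolutely_continuous M (image_law_on A)"
      unfolding absolutely_continuous_def null_M using that
      by (auto simp: null_sets_image_law_on null_sets_distr_iff[OF T] intro: null_set_Int2)
    then show ?thesis
      by (simp add: m_def M.density_RN_deriv)
  qed
  have int_m: "(\<integral>\<^sup>+t\<in>C. m t A \<partial>M) = emeasure \<mu> ((T -` C \<inter> space \<mu>) \<inter> A)"
    if "A \<in> sets \<mu>" "C \<in> sets G" for A C
    using that dens[OF that(1)] emeasure_image_law_on[OF that] emeasure_density[of "\<lambda>t. m t A" M C]
    by simp
  \<comment> \<open>Monotonicity localized to \<open>C\<close>: over \<open>C\<close>, the set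
    \<open>B\<close> splits into \<open>A\<close> and \<open>B - A\<close>. An additive identity of
    densities is used, since subtraction would break down at infinite values.\<close>
  have m_le: "AE t in M. t \<in> C \<longrightarrow> m t A \<le> m t B"
    if [measurable]: "A \<in> sets \<mu>" "B \<in> sets \<mu>" "C \<in> sets G"
      and sub: "(T -` C \<inter> space \<mu>) \<inter> A \<subseteq> B" for A B C
  proof -
    have "AE t in M. m t B * indicator C t = (m t A + m t (B - A)) * indicator C t"
    proof (rule M.AE_eq_if_set_nn_integral_eq)
      fix C' assume "C' \<in> sets M"
      then have [measurable]: "C' \<in> sets G" by simp
      let ?T = "T -` (C \<inter> C') \<inter> space \<mu>"
      have "?T \<in> sets \<mu>" by measurable
      then have "emeasure \<mu> (?T \<inter> B) = emeasure \<mu> (?T \<inter> A) + emeasure \<mu> (?T \<inter> (B - A))"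
        using sub by (subst plus_emeasure) (auto intro!: arg_cong[where f = "emeasure \<mu>"])
      then have "(\<integral>\<^sup>+t\<in>C \<inter> C'. m t B \<partial>M) = (\<integral>\<^sup>+t\<in>C \<inter> C'. (m t A + m t (B - A)) \<partial>M)"
        by (simp add: int_m nn_integral_add distrib_right)
      then show "(\<integral>\<^sup>+t\<in>C'. (m t B * indicator C t) \<partial>M) =
          (\<integral>\<^sup>+t\<in>C'. ((m t A + m t (B - A)) * indicator C t) \<partial>M)"
        by (simp add: indicator_inter_arith mult.assoc)
    qed measurable
    then show ?thesis
      by eventually_elim (auto simp: indicator_def)
  qed
  have m_fin: "AE t in M. m t A < \<infinity>" if A: "A \<in> sets \<mu>" "emeasure \<mu> A < \<infinity>" for A
  proof -
    have "(\<integral>\<^sup>+t. m t A \<partial>M) = (\<integral>\<^sup>+t\<in>space G. m t A \<partial>M)"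
      by (auto intro!: nn_integral_cong)
    also have "\<dots> \<le> emeasure \<mu> A"
      using A by (subst int_m) (auto intro!: emeasure_mono)
    finally have "(\<integral>\<^sup>+t. m t A \<partial>M) \<noteq> \<infinity>"
      using A(2) by auto
    then show ?thesis
      using nn_integral_PInf_AE[of "\<lambda>t. m t A" M] by (simp add: less_top)
  qed
  \<comment> \<open>As \<open>m t A\<close> is the density of \<open>image_law_on A\<close>, that
    measure ignores the \<open>t\<close> with \<open>m t A = 0\<close>. This is what makes the
    denominators \<open>m t B\<close> positive.\<close>
  have AE_law_on: "(AE t in image_law_on A. P t) \<longleftrightarrow> (AE t in M. 0 < m t A \<longrightarrow> P t)"
    if "A \<in> sets \<mu>" for A P
    unfolding dens[OF that, symmetric] by (rule AE_density) simp

  \<comment> \<open>Countable additivity of the densities\<close>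
  have srm: "strong_random_measure \<mu> image_law m"
    unfolding strong_random_measure_def
  proof (intro conjI ballI allI impI)
    show "ae_borel_measurable image_law (\<lambda>t. m t A)" for A
      unfolding ae_borel_measurable_iff by (intro bexI[of _ "\<lambda>t. m t A"]) auto
    have "AE t in M. m t {} = 0"
      by (rule M.AE_eq_if_set_nn_integral_eq) (auto simp: int_m)
    then show "AE t in image_law. m t {} = 0" by (simp add: AE_M)
  next
    fix A :: "nat \<Rightarrow> 'x set" assume A: "range A \<subseteq> sets \<mu>" "disjoint_family A"
    then have [measurable]: "A i \<in> sets \<mu>" for i by auto
    have "AE t in M. m t (\<Union>i. A i) = (\<Sum>i. m t (A i))"
    proof (rule M.AE_eq_if_set_nn_integral_eq)
      fix C assume "C \<in> sets M"
      then have [measurable]: "C \<in> sets G" by simp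
      let ?T = "T -` C \<inter> space \<mu>"
      have [measurable]: "?T \<in> sets \<mu>" by measurable
      have "(\<integral>\<^sup>+t\<in>C. m t (\<Union>i. A i) \<partial>M) = emeasure \<mu> (\<Union>i. ?T \<inter> A i)"
        by (simp add: int_m)
      also have "\<dots> = (\<Sum>i. emeasure \<mu> (?T \<inter> A i))"
        using A by (intro suminf_emeasure[symmetric]) (auto simp: disjoint_family_on_def)
      also have "\<dots> = (\<Sum>i. \<integral>\<^sup>+t\<in>C. m t (A i) \<partial>M)"
        by (simp add: int_m)
      also have "\<dots> = (\<integral>\<^sup>+t\<in>C. (\<Sum>i. m t (A i)) \<partial>M)"
        by (subst nn_integral_suminf[symmetric]) auto
      finally show "(\<integral>\<^sup>+t\<in>C. m t (\<Union>i. A i) \<partial>M) = (\<integral>\<^sup>+t\<in>C. (\<Sum>i. m t (A i)) \<partial>M)" .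
    qed measurable
    then show "AE t in image_law. m t (\<Union>i. A i) = (\<Sum>i. m t (A i))" by (simp add: AE_M)
  qed

  \<comment> \<open>The disintegration identity\<close>
  have cl: "conditional_law \<mu> G T m"
    unfolding conditional_law_def
  proof (intro conjI ballI impI srm)
    fix B assume B[measurable]: "B \<in> sets \<mu>" and B_fin: "0 < emeasure \<mu> B \<and> emeasure \<mu> B < \<infinity>"
    then have fin: "AE t in M. m t B < \<infinity>" by (intro m_fin) auto
    then show "AE t in image_law_on B. 0 < m t B \<and> m t B < \<infinity>"
      by (auto simp: AE_law_on)
  next
    fix B assume B[measurable]: "B \<in> sets \<mu>" and B_fin: "0 < emeasure \<mu> B \<and> emeasure \<mu> B < \<infinity>"
    then have fin: "AE t in M. m t B < \<infinity>" by (intro m_fin) auto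
    fix A C assume [measurable]: "A \<in> sets \<mu>" "C \<in> sets G"
    have "T -` C \<inter> space \<mu> \<in> sets \<mu>" by measurable
    then have "emeasure (cond_on \<mu> B) (A \<inter> (T -` C \<inter> space \<mu>)) = (\<integral>\<^sup>+t\<in>C. m t (A \<inter> B) \<partial>M)"
      by (simp add: emeasure_cond_on int_m) (simp add: ac_simps)
    \<comment> \<open>Cancelling \<open>m t B\<close> is valid also where it vanishes, because
      \<open>m_le\<close> then forces \<open>m t (A \<inter> B) = 0\<close>.\<close>
    also have "\<dots> = (\<integral>\<^sup>+t. m t B * (m t (A \<inter> B) / m t B * indicator C t) \<partial>M)"
    proof (rule nn_integral_cong_AE)
      have "AE t in M. t \<in> space G \<longrightarrow> m t (A \<inter> B) \<le> m t B"
        by (rule m_le) auto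
      with fin AE_space show "AE t in M. m t (A \<inter> B) * indicator C t =
          m t B * (m t (A \<inter> B) / m t B * indicator C t)"
      proof eventually_elim
        case (elim t)
        then have "m t (A \<inter> B) / m t B * m t B = m t (A \<inter> B)"
          by (cases "m t B = 0") (auto simp: divide_mult_eq ennreal_divide_times ennreal_mult_divide_eq)
        then show ?case by (simp add: mult.assoc[symmetric] mult.commute[of "m t B"])
      qed
    qed
    also have "\<dots> = (\<integral>\<^sup>+t\<in>C. (m t (A \<inter> B) / m t B) \<partial>(image_law_on B))"
      unfolding dens[OF B, symmetric] by (rule nn_integral_density[symmetric]) measurable
    finally show "emeasure (cond_on \<mu> B) (A \<inter> (T -` C \<inter> space \<mu>)) =
        (\<integral>\<^sup>+t\<in>C. (m t (A \<inter> B) / m t B) \<partial>(image_law_on B))" .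
  qed

  \<comment> \<open>\<sigma>-finiteness of the constructed law\<close>
  obtain D :: "nat \<Rightarrow> 'x set" where D: "range D \<subseteq> sets \<mu>" "(\<Union>n. D n) = space \<mu>"
    "\<And>n. emeasure \<mu> (D n) \<noteq> \<infinity>" "incseq D"
    using \<mu>.sigma_finite_incseq by blast
  have Dn[measurable]: "D n \<in> sets \<mu>" for n using D(1) by auto
  \<comment> \<open>With respect to \<open>image_law_on (D n)\<close> the index \<open>n\<close>
    itself is a witness; the cover lemma turns this into a statement for
    \<open>image_law\<close>.\<close>
  have ex_pos: "AE t in M. \<exists>n. 0 < m t (D n)"
    unfolding AE_M[symmetric]
    by (rule AE_image_law_if_cover[OF D(1,2)]) (auto simp: AE_law_on)
  define N where "N t = (LEAST n. 0 < m t (D n))" for t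
  have N[measurable]: "N \<in> measurable G (count_space UNIV)"
    unfolding N_def[abs_def] by measurable
  define U where "U k = {x \<in> space \<mu>. x \<in> D (N (T x) + k)}" for k
  have U[measurable]: "U k \<in> sets \<mu>" for k
  proof -
    have "U k = (\<Union>n. {x \<in> space \<mu>. N (T x) = n} \<inter> D (n + k))"
      using D(2) by (auto simp: U_def)
    also have "\<dots> \<in> sets \<mu>" by measurable
    finally show ?thesis .
  qed
  have U_bd: "AE t in M. 0 < m t (U k) \<and> m t (U k) < \<infinity>" for k
  proof -
    \<comment> \<open>Over \<open>C n\<close> the set \<open>U k\<close> coincides with
      \<open>D (n + k)\<close>. So \<open>m t (U k)\<close> is at least \<open>m t (D n)\<close>,
      positive by the choice of \<open>N\<close>, and at most the finite
      \<open>m t (D (n + k))\<close>.\<close>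
    define C where "C n = {t \<in> space G. N t = n}" for n
    have [measurable]: "C n \<in> sets G" for n unfolding C_def by measurable
    have "AE t in M. t \<in> C n \<longrightarrow> m t (D n) \<le> m t (U k)" for n
      by (rule m_le) (use incseqD[OF D(4), of n "n + k"] in \<open>auto simp: C_def U_def\<close>)
    then have low: "AE t in M. \<forall>n. t \<in> C n \<longrightarrow> m t (D n) \<le> m t (U k)"
      by (simp add: AE_all_countable)
    have "AE t in M. t \<in> C n \<longrightarrow> m t (U k) \<le> m t (D (n + k))" for n
      by (rule m_le) (auto simp: C_def U_def)
    then have up: "AE t in M. \<forall>n. t \<in> C n \<longrightarrow> m t (U k) \<le> m t (D (n + k))"
      by (simp add: AE_all_countable)
    have "AE t in M. m t (D n) < \<infinity>" for n
      using D(3)[of n] by (intro m_fin) (auto simp: less_top)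
    then have fin: "AE t in M. \<forall>n. m t (D n) < \<infinity>"
      by (simp add: AE_all_countable)
    from low up fin ex_pos AE_space show ?thesis
    proof eventually_elim
      case (elim t)
      then have "t \<in> C (N t)" by (simp add: C_def)
      moreover have "0 < m t (D (N t))"
        unfolding N_def using elim(4) by (rule LeastI_ex)
      ultimately show ?case using elim by (meson le_less_trans less_le_trans)
    qed
  qed
  have "x \<in> (\<Union>k. U k)" if x: "x \<in> space \<mu>" for x
  proof -
    obtain j where "x \<in> D j" using D(2) x by blast
    then have "x \<in> D (N (T x) + j)" using incseqD[OF D(4), of j "N (T x) + j"] by auto
    then show ?thesis using x by (auto simp: U_def)
  qed
  then have "space \<mu> = (\<Union>k. U k)" by (auto simp: U_def)
  then have "sigma_finite_srm \<mu> image_law m"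
    unfolding sigma_finite_srm_def using srm U_bd by (auto simp: AE_M intro!: exI[of _ U])
  with cl show ?thesis
    unfolding sigma_finite_conditional_law_def by blast
qed

end

theorem theorem1:
  fixes \<mu> :: "'x measure" and G :: "'t measure" and T :: "'x \<Rightarrow> 't"
  assumes "sigma_finite_measure \<mu>"
    and "T \<in> measurable \<mu> G"
  shows "(\<exists>m. sigma_finite_conditional_law \<mu> G T m) \<and>
    (\<forall>m m'. sigma_finite_conditional_law \<mu> G T m \<longrightarrow> sigma_finite_conditional_law \<mu> G T m' \<longrightarrow>
      (\<exists>c :: 't \<Rightarrow> ennreal. ae_borel_measurable (distr \<mu> G T) c \<and>
        (AE t in distr \<mu> G T. 0 < c t \<and> c t < \<infinity>) \<and>
        (\<forall>A\<in>sets \<mu>. AE t in distr \<mu> G T. m' t A = c t * m t A)))"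
proof -
  interpret measurable_map \<mu> G T by standard fact
  show ?thesis
    using sigma_finite_conditional_law_exists[OF assms(1)]
      sigma_finite_conditional_law_unique[OF assms(1)] by blast
qed

end
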